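(* Let $\varphi=\frac{1+\sqrt5}{2}$. For $n\in\mathbb{N}_{>0}$ let \[R_n=\inf_{D}\ \sup_{\textsc{Alg}}\ \frac{\mathbb{E}[\textsc{Alg}_n]}{\mathbb{E}[\textsc{Opt}_n]},\] where $D$ ranges over the distributions allowed in the model of the context and $\textsc{Alg}$ over online algorithms. Then $\limsup_{n\to\infty}R_n\le 1/\varphi\approx 0.618$; i.e., for $n\to\infty$ the prophet-inequality over time is at most $1/\varphi$.
   Context: Model (prophet-inequality over time). Fix $n\in\mathbb{N}_{>0}$ and a continuous distribution $D$ with density and cumulative distribution function $F$, supported on non-negative numbers ($F(0)=0$), with finite positive expectation. Random variables $x_1,\dots,x_n$ are i.i.d. with distribution $D$ and revealed one by one. In step $i$, if step $i$ is not covered by an earlier selection, the decider chooses $t_i\in\{1,\dots,n-i+1\}$ and gains $x_i$ for $t_i$ steps (steps $i,\dots,i+t_i-1$ become covered); if step $i$ is covered (i.e. $i\le j+t_j-1$ for some $j<i$), then $t_i=0$. The total value is $\sum_i x_it_i$. An online algorithm chooses $t_i$ knowing only $n$, $D$, $x_1,\dots,x_i$, $t_1,\dots,t_{i-1}$; $\mathbb{E}[\textsc{Alg}_n]$ is its expected total value. $\textsc{Opt}_n$ is the maximum of $\sum_i x_it_i$ over all feasible choices made with full knowledge of $x_1,\dots,x_n$, and $\mathbb{E}[\textsc{Opt}_n]$ its expectation. *)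

theory Defs
  imports "HOL-Probability.Probability"
begin

text \<open>Steps are numbered \<open>1, \<dots>, n\<close>; entries of \<open>x\<close> and \<open>t\<close> outside this range are
  irrelevant.\<close>

definition covered :: "(nat \<Rightarrow> nat) \<Rightarrow> nat \<Rightarrow> bool" where
  "covered t i \<longleftrightarrow> (\<exists>j\<in>{1..<i}. i \<le> j + t j - 1)"

definition feasible :: "nat \<Rightarrow> (nat \<Rightarrow> nat) \<Rightarrow> bool" where
  "feasible n t \<longleftrightarrow>
     (\<forall>i\<in>{1..n}. if covered t i then t i = 0 else t i \<in> {1..n - i + 1})"

definition total_value :: "nat \<Rightarrow> (nat \<Rightarrow> real) \<Rightarrow> (nat \<Rightarrow> nat) \<Rightarrow> real" where
  "total_value n x t = (\<Sum>i=1..n. x i * real (t i))"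

definition Opt :: "nat \<Rightarrow> (nat \<Rightarrow> real) \<Rightarrow> real" where
  "Opt n x = Max {total_value n x t | t. feasible n t}"

lemma finite_total_values: "finite {total_value n x t | t. feasible n t}"
proof (rule finite_subset)
  show "{total_value n x t | t. feasible n t} \<subseteq> total_value n x ` ({1..n} \<rightarrow>\<^sub>E {0..n})"
  proof clarify
    fix t assume t: "feasible n t"
    have "t i \<le> n" if i: "i \<in> {1..n}" for i
    proof (cases "covered t i")
      case True
      then show ?thesis using t i by (auto simp: feasible_def)
    next
      case False
      moreover have "if covered t i then t i = 0 else t i \<in> {1..n - i + 1}"
        using t i unfolding feasible_def by blast
      ultimately have "t i \<le> n - i + 1" by simp
      then show ?thesis using i by auto
    qed
    then have "restrict t {1..n} \<in> {1..n} \<rightarrow>\<^sub>E {0..n}" by auto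
    moreover have "total_value n x t = total_value n x (restrict t {1..n})"
      by (simp add: total_value_def)
    ultimately show "total_value n x t \<in> total_value n x ` ({1..n} \<rightarrow>\<^sub>E {0..n})" by blast
  qed
  show "finite (total_value n x ` ({1..n} \<rightarrow>\<^sub>E {0..n}))"
    by (intro finite_imageI finite_PiE) auto
qed

lemma feasible_exists: "\<exists>t. feasible n t"
proof
  have "\<not> covered (\<lambda>i. 1) i" for i by (auto simp: covered_def)
  then show "feasible n (\<lambda>i. 1)" by (simp add: feasible_def)
qed

text \<open>A policy maps the step \<open>i\<close>, the observations \<open>x\<^sub>1, \<dots>, x\<^sub>i\<close> and the earlier choices
  \<open>t\<^sub>1, \<dots>, t\<^sub>i\<^sub>-\<^sub>1\<close> to the choice \<open>t\<^sub>i\<close>. The restrictions below (with value \<^term>\<open>undefined\<close>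
  elsewhere) are what makes it online.\<close>

type_synonym policy = "nat \<Rightarrow> (nat \<Rightarrow> real) \<Rightarrow> (nat \<Rightarrow> nat) \<Rightarrow> nat"

lemma restrict_fundef_cong [fundef_cong]:
  "I = J \<Longrightarrow> (\<And>i. i \<in> J \<Longrightarrow> f i = g i) \<Longrightarrow> restrict f I = restrict g J"
  by (auto simp: restrict_def)

fun choices :: "policy \<Rightarrow> (nat \<Rightarrow> real) \<Rightarrow> nat \<Rightarrow> nat" where
  "choices A x i = A i (restrict x {1..i}) (restrict (\<lambda>j. choices A x j) {1..<i})"

declare choices.simps [simp del]

definition online_algorithm :: "nat \<Rightarrow> policy \<Rightarrow> bool" where
  "online_algorithm n A \<longleftrightarrow>
     (\<forall>i\<in>{1..n}. \<forall>t\<in>{1..<i} \<rightarrow>\<^sub>E UNIV.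
        (\<lambda>x. A i x t) \<in> (\<Pi>\<^sub>M j\<in>{1..i}. (borel :: real measure)) \<rightarrow>\<^sub>M count_space UNIV) \<and>
     (\<forall>x. feasible n (choices A x))"

definition admissible_distribution :: "real measure \<Rightarrow> bool" where
  "admissible_distribution D \<longleftrightarrow>
     real_distribution D \<and>
     (\<exists>f :: real \<Rightarrow> real. f \<in> borel_measurable borel \<and> (\<forall>y. 0 \<le> f y) \<and>
        D = density lborel (\<lambda>y. ennreal (f y))) \<and>
     cdf D 0 = 0 \<and>
     integrable D (\<lambda>y. y) \<and> 0 < (\<integral>y. y \<partial>D)"

definition iid :: "nat \<Rightarrow> real measure \<Rightarrow> (nat \<Rightarrow> real) measure" where
  "iid n D = (\<Pi>\<^sub>M i\<in>{1..n}. D)"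

definition expected_Alg :: "nat \<Rightarrow> real measure \<Rightarrow> policy \<Rightarrow> real" where
  "expected_Alg n D A = (\<integral>x. total_value n x (choices A x) \<partial>iid n D)"

definition expected_Opt :: "nat \<Rightarrow> real measure \<Rightarrow> real" where
  "expected_Opt n D = (\<integral>x. Opt n x \<partial>iid n D)"

definition prophet_ratio :: "nat \<Rightarrow> ereal" where
  "prophet_ratio n =
     (INF D\<in>{D. admissible_distribution D}. SUP A\<in>{A. online_algorithm n A}.
        ereal (expected_Alg n D A / expected_Opt n D))"

definition golden_ratio :: real where
  "golden_ratio = (1 + sqrt 5) / 2"

end

theory Submission
  imports Defs "HOL-Real_Asymp.Real_Asymp"
begin

text \<open>The hard distribution has, up to smearing by \<open>\<eta>\<close>, three values: usually \<open>0\<close>, with a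
  probability \<open>p\<close> that is small but much larger than \<open>1/n\<close> the value \<open>1\<close>, and with a probability
  \<open>q\<close> much smaller than \<open>1/n\<close> a huge value \<open>M\<close>, where \<open>M q \<approx> \<phi>/n\<close>.
  The prophet gets the running maximum in every step, hence about \<open>1\<close> per step from the value \<open>1\<close> and,
  in addition, the mean contribution \<open>\<phi> n/2\<close> of \<open>M\<close>, in total \<open>n (1 + \<phi>/2)\<close>.
  An online algorithm has to choose in each step between holding a \<open>1\<close> and waiting for an \<open>M\<close>; with
  \<open>j\<close> steps left waiting is worth \<open>M q j \<approx> \<phi> j/n\<close>, so a step brings at most \<open>max 1 (\<phi> j/n)\<close> and
  the total is at most about \<open>n (\<phi> + 1/\<phi>)/2\<close>. The quotient of the two is \<open>1/\<phi>\<close>; among all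
  constants in place of \<open>\<phi>\<close>, the golden ratio minimises it.\<close>

subsection \<open>Feasible choices\<close>

text \<open>Written additively, the upper bound avoids truncated subtraction; it also holds for
  covered steps, where \<open>t i = 0\<close>.\<close>

lemma feasible_iff:
  "feasible n t \<longleftrightarrow> (\<forall>i\<in>{1..n}. if covered t i then t i = 0 else 1 \<le> t i \<and> i + t i \<le> n + 1)"
  unfolding feasible_def by (intro ball_cong refl if_cong) auto

lemma feasibleD:
  assumes "feasible n t" "i \<in> {1..n}"
  shows "covered t i \<Longrightarrow> t i = 0" "\<not> covered t i \<Longrightarrow> 1 \<le> t i" "i + t i \<le> n + 1"
proof -
  have "if covered t i then t i = 0 else 1 \<le> t i \<and> i + t i \<le> n + 1"
    using assms unfolding feasible_iff by blast
  then show "covered t i \<Longrightarrow> t i = 0" "\<not> covered t i \<Longrightarrow> 1 \<le> t i" "i + t i \<le> n + 1"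
    using assms(2) by (auto split: if_splits)
qed

lemma feasible_cover:
  assumes "feasible n t"
  shows "(\<Union>i\<in>{1..n}. {i..<i + t i}) = {1..n}"
proof (intro equalityI subsetI)
  fix s assume "s \<in> (\<Union>i\<in>{1..n}. {i..<i + t i})"
  then obtain i where i: "i \<in> {1..n}" "i \<le> s" "s < i + t i" by auto
  with feasibleD(3)[OF assms, of i] i show "s \<in> {1..n}" by auto
next
  fix s assume s: "s \<in> {1..n}"
  show "s \<in> (\<Union>i\<in>{1..n}. {i..<i + t i})"
  proof (cases "covered t s")
    case True
    then obtain j where "j \<in> {1..<s}" "s \<le> j + t j - 1" by (auto simp: covered_def)
    with s show ?thesis by (auto intro!: bexI[of _ j])
  next
    case False
    with assms s have "t s \<ge> 1" by (intro feasibleD)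
    with s show ?thesis by (auto intro!: bexI[of _ s])
  qed
qed

lemma feasible_disjoint:
  assumes "feasible n t" "i \<in> {1..n}" "j \<in> {1..n}" "i < j"
  shows "{i..<i + t i} \<inter> {j..<j + t j} = {}"
proof (cases "covered t j")
  case True
  with assms show ?thesis using feasibleD(1) by auto
next
  case False
  with assms show ?thesis by (force simp: covered_def)
qed

text \<open>The intervals \<open>{i..<i + t i}\<close> partition the horizon, those of covered steps
  being empty. Any amount attached to single steps can therefore be charged to the selections that
  occupy them.\<close>

lemma feasible_sum:
  fixes f :: "nat \<Rightarrow> real"
  assumes "feasible n t"
  shows "(\<Sum>i=1..n. \<Sum>s\<in>{i..<i + t i}. f s) = (\<Sum>s=1..n. f s)"
proof -
  have "\<forall>i\<in>{1..n}. \<forall>j\<in>{1..n}. i \<noteq> j \<longrightarrow> {i..<i + t i} \<inter> {j..<j + t j} = {}"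
    using feasible_disjoint[OF assms] by (metis inf_commute linorder_neqE_nat)
  then show ?thesis
    by (subst feasible_cover[OF assms, symmetric], subst sum.UNION_disjoint) auto
qed

lemma total_value_bounds:
  assumes t: "feasible n t" and x: "\<And>i. i \<in> {1..n} \<Longrightarrow> x i \<in> {0..B}"
  shows "total_value n x t \<in> {0..real n * B}"
proof -
  have "total_value n x t = (\<Sum>i=1..n. \<Sum>s\<in>{i..<i + t i}. x i)"
    by (simp add: total_value_def mult.commute)
  also have "\<dots> \<le> (\<Sum>i=1..n. \<Sum>s\<in>{i..<i + t i}. B)"
    using x by (intro sum_mono) auto
  also have "\<dots> = real n * B" by (simp add: feasible_sum[OF t, of "\<lambda>_. B", simplified])
  finally have "total_value n x t \<le> real n * B" .
  moreover have "0 \<le> total_value n x t" using x unfolding total_value_def by (intro sum_nonneg) auto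
  ultimately show ?thesis by simp
qed

text \<open>The function \<open>b\<close> plays the role of the increments of a potential: the value of the
  game from step \<open>s\<close> on drops by at most \<open>\<eta> + b s\<close> when step \<open>s\<close> is used up. An algorithm that
  accepts the value \<open>y\<close> in an uncovered step \<open>i\<close> beats the potential by at most \<open>gain n M b i y\<close>,
  whatever duration it chooses.\<close>

definition gain :: "nat \<Rightarrow> real \<Rightarrow> (nat \<Rightarrow> real) \<Rightarrow> nat \<Rightarrow> real \<Rightarrow> real" where
  "gain n M b i y = (if y < 1 then - b i else if y < M then 0 else M * real (n + 1 - i))"

text \<open>Each selection pays \<open>\<eta> + b s\<close> for every step \<open>s\<close> it
  occupies, and \<open>gain\<close> bounds what is left. The bound no longer mentions the duration,
  only whether step \<open>i\<close> is uncovered, which the past alone decides; this allows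
  independence to be used later.\<close>

lemma total_value_le:
  fixes y b :: "nat \<Rightarrow> real"
  assumes t: "feasible n t" and b: "\<And>s. s \<in> {1..n} \<Longrightarrow> 1 \<le> b s" and M: "0 \<le> M"
    and y: "\<And>i. i \<in> {1..n} \<Longrightarrow> y i \<in> {0..\<eta>} \<union> {1..1 + \<eta>} \<union> {M..M + \<eta>}"
    and \<eta>: "\<eta> < 1" "1 + \<eta> < M"
  shows "total_value n y t \<le>
    (\<Sum>s=1..n. \<eta> + b s) + (\<Sum>i=1..n. of_bool (\<not> covered t i) * gain n M b i (y i))"
proof -
  have "(\<Sum>s\<in>{i..<i + t i}. y i - (\<eta> + b s)) \<le> of_bool (\<not> covered t i) * gain n M b i (y i)"
    if i: "i \<in> {1..n}" for i
  proof (cases "covered t i")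
    case True
    with t i show ?thesis using feasibleD(1) by auto
  next
    case False
    with feasibleD(2,3)[OF t i] have ti: "1 \<le> t i" "t i \<le> n + 1 - i" by auto
    have sub: "{i..<i + t i} \<subseteq> {1..n}" using feasible_cover[OF t] i by blast
    consider "y i \<in> {0..\<eta>}" | "y i \<in> {1..1 + \<eta>}" | "y i \<in> {M..M + \<eta>}"
      using y[OF i] by blast
    then show ?thesis
    proof cases
      case 1
      have "(\<Sum>s\<in>{i..<i + t i}. y i - (\<eta> + b s)) \<le> (\<Sum>s\<in>{i..<i + t i}. - b s)"
        using 1 by (intro sum_mono) auto
      \<comment> \<open>Only the charge for step \<open>i\<close> itself is kept, which removes the
        dependence on \<open>t i\<close>.\<close>
      also have "\<dots> \<le> (\<Sum>s\<in>{i}. - b s)"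
        unfolding sum_negf neg_le_iff_le
      proof (rule sum_mono2)
        show "{i} \<subseteq> {i..<i + t i}" using ti by auto
        show "0 \<le> b s" if "s \<in> {i..<i + t i} - {i}" for s
          using b[of s] sub that by fastforce
      qed auto
      finally show ?thesis using 1 \<eta> False by (auto simp: gain_def)
    next
      case 2
      have "(\<Sum>s\<in>{i..<i + t i}. y i - (\<eta> + b s)) \<le> (\<Sum>s\<in>{i..<i + t i}. 0)"
        using 2 b sub by (intro sum_mono) fastforce
      then show ?thesis using 2 \<eta> False by (auto simp: gain_def)
    next
      case 3
      have "(\<Sum>s\<in>{i..<i + t i}. y i - (\<eta> + b s)) \<le> (\<Sum>s\<in>{i..<i + t i}. M)"
        using 3 b sub by (intro sum_mono) fastforce
      also have "\<dots> = M * real (t i)" by simp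
      also have "\<dots> \<le> M * real (n + 1 - i)"
        using ti M by (intro mult_left_mono) auto
      finally show ?thesis using 3 \<eta> M False by (auto simp: gain_def)
    qed
  qed
  then have "(\<Sum>i=1..n. \<Sum>s\<in>{i..<i + t i}. y i - (\<eta> + b s))
      \<le> (\<Sum>i=1..n. of_bool (\<not> covered t i) * gain n M b i (y i))"
    by (rule sum_mono)
  moreover have "(\<Sum>i=1..n. \<Sum>s\<in>{i..<i + t i}. y i - (\<eta> + b s))
      = total_value n y t - (\<Sum>s=1..n. \<eta> + b s)"
    unfolding total_value_def
    by (subst feasible_sum[OF t, symmetric]) (simp add: sum_subtractf mult.commute)
  ultimately show ?thesis by simp
qed

section \<open>Running maxima as a lower bound for the prophet\<close>

text \<open>The prophet holds the current record until a larger value appears. The induction carries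
  the holder \<open>j\<close> of the record, whose selection runs to the end of the horizon: a new
  step either starts a selection of length one or prolongs that of \<open>j\<close>.\<close>

lemma feasible_prefix_max:
  fixes x :: "nat \<Rightarrow> real"
  assumes "0 < n"
  shows "\<exists>t j. feasible n t \<and> total_value n x t = (\<Sum>k=1..n. Max (x ` {1..k})) \<and>
    j \<in> {1..n} \<and> x j = Max (x ` {1..n}) \<and> j + t j = n + 1"
  using assms
proof (induction n rule: nat_induct_non_zero)
  case 1
  have "\<not> covered (\<lambda>i. 1) 1" by (auto simp: covered_def)
  then show ?case
    by (intro exI[of _ "\<lambda>i. 1"] exI[of _ 1]) (auto simp: feasible_def total_value_def)
next
  case (Suc n)
  then obtain t j where t: "feasible n t" and v: "total_value n x t = (\<Sum>k=1..n. Max (x ` {1..k}))"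
    and j: "j \<in> {1..n}" "x j = Max (x ` {1..n})" "j + t j = n + 1" by blast
  have max: "Max (x ` {1..Suc n}) = max (x (Suc n)) (Max (x ` {1..n}))"
    using \<open>0 < n\<close> by (simp add: atLeastAtMostSuc_conv)
  note bound = feasibleD(3)[OF t]
  show ?case
  proof (cases "x (Suc n) > Max (x ` {1..n})")
    case True
    let ?t = "t(Suc n := 1)"
    have cov: "covered ?t i = covered t i" if "i \<le> Suc n" for i
      using that by (auto simp: covered_def)
    \<comment> \<open>All earlier selections end by step \<open>n\<close>, since
      \<open>i + t i \<le> n + 1\<close>.\<close>
    have "\<not> covered t (Suc n)" using bound by (fastforce simp: covered_def)
    have "if covered ?t i then ?t i = 0 else 1 \<le> ?t i \<and> i + ?t i \<le> Suc n + 1"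
      if "i \<in> {1..Suc n}" for i
    proof (cases "i = Suc n")
      case True
      with \<open>\<not> covered t (Suc n)\<close> cov[of i] show ?thesis by simp
    next
      case False
      with that have i: "i \<in> {1..n}" by auto
      with feasibleD[OF t i] cov[of i] show ?thesis by auto
    qed
    then have "feasible (Suc n) ?t" unfolding feasible_iff by blast
    moreover have "total_value (Suc n) x ?t = (\<Sum>k=1..Suc n. Max (x ` {1..k}))"
      using v True max by (simp add: total_value_def)
    moreover have "Suc n \<in> {1..Suc n} \<and> x (Suc n) = Max (x ` {1..Suc n}) \<and> Suc n + ?t (Suc n) = Suc n + 1"
      using True max by simp
    ultimately show ?thesis by blast
  next
    case False
    let ?t = "t(j := t j + 1, Suc n := 0)"
    have cov: "covered ?t i = covered t i" if "i \<in> {1..n}" for i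
      unfolding covered_def using that j by (intro bex_cong) auto
    have "covered ?t (Suc n)" using j by (auto simp: covered_def intro!: bexI[of _ j])
    \<comment> \<open>From \<open>j \<le> n\<close> and \<open>j + t j = n + 1\<close> it follows
      that \<open>t j\<close> is positive.\<close>
    moreover have "\<not> covered t j" using feasibleD(1)[OF t j(1)] j by auto
    ultimately have "if covered ?t i then ?t i = 0 else 1 \<le> ?t i \<and> i + ?t i \<le> Suc n + 1"
      if "i \<in> {1..Suc n}" for i
    proof (cases "i = Suc n")
      case False
      with that have i: "i \<in> {1..n}" by auto
      with feasibleD[OF t i] cov[of i] j \<open>\<not> covered t j\<close> show ?thesis by auto
    qed simp
    then have "feasible (Suc n) ?t" unfolding feasible_iff by blast
    moreover have "total_value (Suc n) x ?t = (\<Sum>k=1..Suc n. Max (x ` {1..k}))"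
    proof -
      have "total_value (Suc n) x ?t = (\<Sum>i=1..n. x i * real (?t i))"
        by (simp add: total_value_def)
      also have "\<dots> = (\<Sum>i=1..n. x i * real (t i) + of_bool (i = j) * x i)"
        by (rule sum.cong) (auto simp: algebra_simps)
      also have "\<dots> = total_value n x t + (\<Sum>i=1..n. of_bool (i = j) * x i)"
        by (simp add: total_value_def sum.distrib)
      also have "(\<Sum>i=1..n. of_bool (i = j) * x i) = (\<Sum>i=1..n. if i = j then x i else 0)"
        by (rule sum.cong) auto
      also have "\<dots> = x j" using j by simp
      finally have "total_value (Suc n) x ?t = total_value n x t + x j" .
      then show ?thesis unfolding v using False max j by (simp only:) simp
    qed
    moreover have "j \<in> {1..Suc n} \<and> x j = Max (x ` {1..Suc n}) \<and> j + ?t j = Suc n + 1"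
      using False max j by auto
    ultimately show ?thesis by blast
  qed
qed

lemma sum_prefix_max_le_Opt: "(\<Sum>k=1..n. Max (x ` {1..k})) \<le> Opt n x"
proof (cases "n = 0")
  case True
  have "Opt 0 x \<ge> 0" unfolding Opt_def
    using feasible_exists[of 0] finite_total_values[of 0 x] by (intro Max_ge) (auto simp: total_value_def)
  with True show ?thesis by simp
next
  case False
  with feasible_prefix_max[of n x] finite_total_values[of n x] show ?thesis
    unfolding Opt_def by (metis (mono_tags, lifting) Max_ge gr0I mem_Collect_eq)
qed

subsection \<open>Independence of the current value from the past\<close>

text \<open>A choice reads only \<open>x\<close> on \<open>{1..i}\<close> and the earlier choices;
  the latter are handled by strong induction.\<close>

lemma choices_restrict:
  assumes "{1..i} \<subseteq> J"
  shows "choices A (restrict x J) i = choices A x i"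
  using assms
proof (induction i rule: less_induct)
  case (less i)
  have "restrict (restrict x J) {1..i} = restrict x {1..i}"
    using less.prems by (auto simp: restrict_def fun_eq_iff)
  moreover have "choices A (restrict x J) j = choices A x j" if "j \<in> {1..<i}" for j
    using that less.prems by (intro less.IH) auto
  then have "restrict (choices A (restrict x J)) {1..<i} = restrict (choices A x) {1..<i}"
    by (intro restrict_ext) auto
  ultimately show ?case by (simp only: choices.simps[of A _ i])
qed

text \<open>Measurability of \<open>A\<close> is given for each fixed history of choices. There are
  only countably many histories, so the random history may be substituted.\<close>

lemma measurable_choices:
  assumes A: "online_algorithm n A" and "i \<in> {1..n}" "{1..i} \<subseteq> J"
  shows "(\<lambda>x. choices A x i) \<in> (\<Pi>\<^sub>M j\<in>J. (borel :: real measure)) \<rightarrow>\<^sub>M count_space UNIV"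
  using assms(2,3)
proof (induction i rule: less_induct)
  case (less i)
  let ?P = "\<Pi>\<^sub>M j\<in>J. (borel :: real measure)"
  let ?T = "{1..<i} \<rightarrow>\<^sub>E (UNIV :: nat set)"
  have "(\<lambda>x. A i (restrict x {1..i}) t) \<in> ?P \<rightarrow>\<^sub>M count_space UNIV" if "t \<in> ?T" for t
  proof -
    have r: "(\<lambda>x. restrict x {1..i}) \<in> ?P \<rightarrow>\<^sub>M (\<Pi>\<^sub>M j\<in>{1..i}. borel)"
      using less.prems by (intro measurable_restrict_subset) auto
    have "(\<lambda>x. A i x t) \<in> (\<Pi>\<^sub>M j\<in>{1..i}. borel) \<rightarrow>\<^sub>M count_space UNIV"
      using A less.prems that unfolding online_algorithm_def by blast
    from measurable_compose[OF r this] show ?thesis .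
  qed
  moreover have "(\<lambda>x. restrict (choices A x) {1..<i}) \<in> ?P \<rightarrow>\<^sub>M (\<Pi>\<^sub>M j\<in>{1..<i}. count_space UNIV)"
    by (intro measurable_restrict less.IH) (use less.prems in auto)
  then have "(\<lambda>x. restrict (choices A x) {1..<i}) \<in> ?P \<rightarrow>\<^sub>M count_space ?T"
    by (simp add: count_space_PiM_finite)
  moreover have "countable ?T" by (intro countable_PiE) auto
  ultimately have "(\<lambda>x. A i (restrict x {1..i}) (restrict (choices A x) {1..<i})) \<in> ?P \<rightarrow>\<^sub>M count_space UNIV"
    by (rule measurable_compose_countable')
  then show ?case by (subst choices.simps) (simp add: restrict_def)
qed

text \<open>Coverage of step \<open>i\<close> is settled before \<open>x i\<close> is
  revealed.\<close>

lemma covered_choices_restrict: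
  "covered (choices A (restrict x {1..<i})) i = covered (choices A x) i"
proof -
  have "choices A (restrict x {1..<i}) j = choices A x j" if "j \<in> {1..<i}" for j
    using that by (intro choices_restrict) auto
  then show ?thesis by (simp add: covered_def)
qed

lemma measurable_covered_choices:
  assumes A: "online_algorithm n A" and "i \<in> {1..n}" "{1..<i} \<subseteq> J"
  shows "Measurable.pred (\<Pi>\<^sub>M j\<in>J. (borel :: real measure)) (\<lambda>x. covered (choices A x) i)"
  unfolding covered_def
proof (rule pred_intros_finite)
  fix j assume j: "j \<in> {1..<i}"
  have "(\<lambda>x. choices A x j) \<in> (\<Pi>\<^sub>M j\<in>J. (borel :: real measure)) \<rightarrow>\<^sub>M count_space UNIV"
    using j assms by (intro measurable_choices[OF A]) auto
  then show "Measurable.pred (\<Pi>\<^sub>M j\<in>J. (borel :: real measure)) (\<lambda>x. i \<le> j + choices A x j - 1)"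
    by (rule measurable_compose) simp
qed simp

lemma indep_vars_PiM_components:
  assumes "\<And>i. i \<in> I \<Longrightarrow> prob_space (M i)"
  shows "prob_space.indep_vars (PiM I M) M (\<lambda>i x. x i) I"
proof (cases "I = {}")
  case True
  interpret prob_space "PiM I M" by (rule prob_space_PiM) (use assms in auto)
  show ?thesis using True unfolding indep_vars_def indep_sets_def by auto
next
  case False
  interpret prob_space "PiM I M" by (rule prob_space_PiM) (use assms in auto)
  \<comment> \<open>On the product space, restricting to \<open>I\<close> is the identity, so the
    joint law is the product of the marginals.\<close>
  have "distr (PiM I M) (PiM I M) (\<lambda>x. restrict x I) = distr (PiM I M) (PiM I M) (\<lambda>x. x)"
    by (intro distr_cong) (auto simp: space_PiM PiE_def extensional_restrict)
  also have "\<dots> = PiM I (\<lambda>i. distr (PiM I M) (M i) (\<lambda>x. x i))"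
    using assms by (auto intro!: PiM_cong simp: distr_PiM_component)
  finally show ?thesis
    using False by (subst indep_vars_iff_distr_eq_PiM') auto
qed

section \<open>Expectations under an i.i.d. sample\<close>

locale real_prob = prob_space D for D :: "real measure" +
  assumes sets_D [measurable_cong]: "sets D = sets borel"
begin

lemma prob_space_iid: "prob_space (iid n D)"
  unfolding iid_def by (intro prob_space_PiM prob_space_axioms)

lemma sets_iid [measurable_cong]: "sets (iid n D) = sets (\<Pi>\<^sub>M i\<in>{1..n}. borel)"
  unfolding iid_def by (intro sets_PiM_cong refl sets_D)

lemma distr_iid_component: "i \<in> {1..n} \<Longrightarrow> distr (iid n D) D (\<lambda>x. x i) = D"
  unfolding iid_def by (rule distr_PiM_component) (auto intro: prob_space_axioms)

lemma measurable_iid_component: "i \<in> {1..n} \<Longrightarrow> (\<lambda>x. x i) \<in> iid n D \<rightarrow>\<^sub>M D"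
  unfolding iid_def by measurable

lemma AE_iid:
  assumes "AE y in D. P y"
  shows "AE x in iid n D. \<forall>i\<in>{1..n}. P (x i)"
proof (rule AE_finite_allI)
  fix i assume i: "i \<in> {1..n}"
  show "AE x in iid n D. P (x i)"
    using assms distr_iid_component[OF i] measurable_iid_component[OF i] AE_distrD by metis
qed simp

text \<open>The indicator depends on the values before step \<open>i\<close> and
  \<open>g (x i)\<close> on the value at step \<open>i\<close>, so the two are independent and the
  expectation factorises.\<close>

lemma integral_uncovered:
  fixes g :: "real \<Rightarrow> real"
  assumes A: "online_algorithm n A" and i: "i \<in> {1..n}" and g: "integrable D g"
  shows "integrable (iid n D) (\<lambda>x. of_bool (\<not> covered (choices A x) i) * g (x i))"
    and "(\<integral>x. of_bool (\<not> covered (choices A x) i) * g (x i) \<partial>iid n D)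
      = (\<integral>x. of_bool (\<not> covered (choices A x) i) \<partial>iid n D) * (\<integral>y. g y \<partial>D)"
proof -
  interpret P: prob_space "iid n D" by (rule prob_space_iid)
  let ?u = "\<lambda>x. of_bool (\<not> covered (choices A x) i) :: real"
  note comp = measurable_iid_component[OF i]
  have [measurable]: "Measurable.pred (iid n D) (\<lambda>x. covered (choices A x) i)"
    unfolding measurable_cong_sets[OF sets_iid refl]
    using i by (intro measurable_covered_choices[OF A]) auto
  have gm [measurable]: "g \<in> borel_measurable D" using g by auto
  have ind: "P.indep_vars (\<lambda>_. D) (\<lambda>i x. x i) {1..n}"
    unfolding iid_def by (intro indep_vars_PiM_components prob_space_axioms)
  \<comment> \<open>The coordinates are grouped into the past and the present; both factors are then
    functions of these groups.\<close>
  have "P.indep_var (\<Pi>\<^sub>M j\<in>{1..<i}. D) (\<lambda>x. restrict x {1..<i}) (\<Pi>\<^sub>M j\<in>{i}. D) (\<lambda>x. restrict x {i})"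
    using i by (intro P.indep_var_restrict[OF ind, of "{1..<i}" "{i}"]) auto
  moreover have "?u \<in> borel_measurable (\<Pi>\<^sub>M j\<in>{1..<i}. D)"
  proof -
    have sets_eq: "sets (\<Pi>\<^sub>M j\<in>{1..<i}. D) = sets (\<Pi>\<^sub>M j\<in>{1..<i}. borel)"
      by (intro sets_PiM_cong refl sets_D)
    have [measurable]: "Measurable.pred (\<Pi>\<^sub>M j\<in>{1..<i}. D) (\<lambda>x. covered (choices A x) i)"
      unfolding measurable_cong_sets[OF sets_eq refl]
      by (intro measurable_covered_choices[OF A i]) auto
    show ?thesis by measurable
  qed
  moreover have "(\<lambda>x. g (x i)) \<in> borel_measurable (\<Pi>\<^sub>M j\<in>{i}. D)" by measurable
  ultimately have "P.indep_var borel (?u \<circ> (\<lambda>x. restrict x {1..<i})) borel ((\<lambda>x. g (x i)) \<circ> (\<lambda>x. restrict x {i}))"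
    by (rule P.indep_var_compose)
  then have indep: "P.indep_var borel ?u borel (\<lambda>x. g (x i))"
    by (simp add: o_def covered_choices_restrict del: One_nat_def)
  have u: "integrable (iid n D) ?u"
    by (intro P.integrable_const_bound[of _ 1]) auto
  have gi: "integrable (iid n D) (\<lambda>x. g (x i))"
    using g distr_iid_component[OF i] integrable_distr_eq[OF comp gm] by simp
  have "(\<integral>x. g (x i) \<partial>iid n D) = (\<integral>y. g y \<partial>D)"
    using integral_distr[OF comp gm] distr_iid_component[OF i] by simp
  then show "(\<integral>x. ?u x * g (x i) \<partial>iid n D) = (\<integral>x. ?u x \<partial>iid n D) * (\<integral>y. g y \<partial>D)"
    using P.indep_var_lebesgue_integral[OF indep u gi] by simp
  show "integrable (iid n D) (\<lambda>x. ?u x * g (x i))"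
    by (rule P.indep_var_integrable[OF indep u gi])
qed

text \<open>Restricting choices to \<open>{1..n}\<close> turns \<open>Opt\<close> into a maximum
  over a finite set \<open>T\<close> that does not depend on \<open>x\<close>.\<close>

lemma borel_measurable_Opt: "Opt n \<in> borel_measurable (iid n D)"
proof -
  define T where "T = {t \<in> {1..n} \<rightarrow>\<^sub>E {0..n}. feasible n t}"
  have "{total_value n x t | t. feasible n t} = (\<lambda>t. total_value n x t) ` T" for x
  proof -
    have "total_value n x t \<in> (\<lambda>t. total_value n x t) ` T" if t: "feasible n t" for t
    proof -
      let ?t = "restrict t {1..n}"
      have "covered ?t i = covered t i" if "i \<in> {1..n}" for i
        using that by (auto simp: covered_def)
      then have "feasible n ?t" using t by (auto simp: feasible_iff)
      moreover have "?t \<in> {1..n} \<rightarrow>\<^sub>E {0..n}" using feasibleD(3)[OF t] by fastforce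
      moreover have "total_value n x ?t = total_value n x t" by (simp add: total_value_def)
      ultimately show ?thesis unfolding T_def by (metis (mono_tags, lifting) image_eqI mem_Collect_eq)
    qed
    then show ?thesis by (auto simp: T_def)
  qed
  then have "Opt n = (\<lambda>x. Max ((\<lambda>t. total_value n x t) ` T))" by (auto simp: Opt_def)
  moreover have "finite T"
    unfolding T_def by (rule finite_subset[of _ "{1..n} \<rightarrow>\<^sub>E {0..n}"]) (auto intro: finite_PiE)
  moreover have "(\<lambda>x. total_value n x t) \<in> borel_measurable (iid n D)" for t
    unfolding total_value_def by measurable
  ultimately show ?thesis by simp
qed

lemma integrable_Opt:
  assumes "AE y in D. y \<in> {0..B}"
  shows "integrable (iid n D) (Opt n)"
proof -
  interpret P: prob_space "iid n D" by (rule prob_space_iid)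
  have "Opt n x \<in> {0..real n * B}" if "\<forall>i\<in>{1..n}. x i \<in> {0..B}" for x
  proof -
    have "Opt n x \<in> {total_value n x t | t. feasible n t}"
      unfolding Opt_def using feasible_exists[of n] by (intro Max_in finite_total_values) auto
    then obtain t where "feasible n t" "Opt n x = total_value n x t" by blast
    with total_value_bounds[of n t x B] that show ?thesis by simp
  qed
  then have "AE x in iid n D. norm (Opt n x) \<le> real n * B"
    using AE_iid[OF assms, of n] by (auto elim!: eventually_mono)
  then show ?thesis by (intro P.integrable_const_bound borel_measurable_Opt)
qed

text \<open>The running maximum is at least \<open>M\<close> once a value reaches \<open>M\<close>,
  at least 1 once a value reaches 1, and nonnegative otherwise.\<close>

lemma integral_prefix_max_ge:
  assumes Y: "AE y in D. y \<in> {0..B}" and M: "1 \<le> M" and k: "k \<in> {1..n}"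
  shows "integrable (iid n D) (\<lambda>x. Max (x ` {1..k}))"
    and "(\<integral>x. Max (x ` {1..k}) \<partial>iid n D)
      \<ge> M - (M - 1) * prob {..<M} ^ k - prob {..<1} ^ k"
proof -
  interpret P: prob_space "iid n D" by (rule prob_space_iid)
  interpret Q: product_prob_space "\<lambda>_. D" "{1..n}" by unfold_locales
  have "(\<lambda>x. Max ((\<lambda>i. x i) ` {1..k})) \<in> borel_measurable (iid n D)"
    using k by (intro borel_measurable_Max) auto
  moreover have "Max (x ` {1..k}) \<in> {0..B}" if "\<forall>i\<in>{1..n}. x i \<in> {0..B}" for x
  proof -
    have "Max (x ` {1..k}) \<in> x ` {1..k}" using k by (intro Max_in) auto
    then obtain i where "i \<in> {1..k}" "Max (x ` {1..k}) = x i" by blast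
    with that k show ?thesis by auto
  qed
  then have "AE x in iid n D. norm (Max (x ` {1..k})) \<le> B"
    using AE_iid[OF Y, of n] by (auto elim!: eventually_mono)
  ultimately show int: "integrable (iid n D) (\<lambda>x. Max (x ` {1..k}))"
    by (intro P.integrable_const_bound) auto
  define E where "E a = {x \<in> space (iid n D). \<forall>i\<in>{1..k}. x i \<in> {..<a}}" for a :: real
  have E: "E a \<in> P.events" for a
  proof -
    have "Measurable.pred (iid n D) (\<lambda>x. \<forall>i\<in>{1..k}. x i \<in> {..<a})"
    proof (rule pred_intros_finite)
      fix i assume "i \<in> {1..k}"
      then show "Measurable.pred (iid n D) (\<lambda>x. x i \<in> {..<a})"
        using k by (intro pred_sets2[OF _ measurable_iid_component]) (auto simp: sets_D)
    qed simp
    then show ?thesis unfolding E_def pred_def .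
  qed
  have PE: "P.prob (E a) = prob {..<a} ^ k" for a
  proof -
    have "emeasure (iid n D) (E a) = (\<Prod>i\<in>{1..k}. emeasure D {..<a})"
      unfolding iid_def E_def using k by (intro Q.emeasure_PiM_Collect) (auto simp: sets_D)
    also have "\<dots> = ennreal (prob {..<a} ^ k)"
      by (simp add: emeasure_eq_measure ennreal_power)
    finally show ?thesis by (simp add: measure_def)
  qed
  \<comment> \<open>On \<open>E a\<close> the first \<open>k\<close> values are all below
    \<open>a\<close>. As \<open>E 1\<close> lies inside \<open>E M\<close>, the function
    \<open>?h\<close> equals 0 on \<open>E 1\<close>, 1 on the rest of \<open>E M\<close>, and
    \<open>M\<close> elsewhere.\<close>
  let ?h = "\<lambda>x. M - (M - 1) * indicator (E M) x - indicator (E 1) x"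
  have "(\<integral>x. ?h x \<partial>iid n D) = M - (M - 1) * prob {..<M} ^ k - prob {..<1} ^ k"
    using E by (simp add: PE P.prob_space P.integrable_const_bound P.emeasure_eq_measure)
  moreover have "(\<integral>x. ?h x \<partial>iid n D) \<le> (\<integral>x. Max (x ` {1..k}) \<partial>iid n D)"
  proof (rule integral_mono_AE[OF _ int])
    show "integrable (iid n D) ?h" using E by (auto simp: P.emeasure_eq_measure)
    show "AE x in iid n D. ?h x \<le> Max (x ` {1..k})"
      using AE_iid[OF Y, of n] AE_space
    proof eventually_elim
      case (elim x)
      have in_E: "x \<in> E a \<longleftrightarrow> Max (x ` {1..k}) < a" for a
        using elim k by (subst Max_less_iff) (auto simp: E_def)
      have "x 1 \<le> Max (x ` {1..k})" using k by (intro Max_ge) auto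
      moreover have "0 \<le> x 1" using bspec[OF elim(1), of 1] k by simp
      ultimately have "0 \<le> Max (x ` {1..k})" by simp
      then show ?case using M by (auto simp: indicator_def in_E)
    qed
  qed
  ultimately show "(\<integral>x. Max (x ` {1..k}) \<partial>iid n D)
      \<ge> M - (M - 1) * prob {..<M} ^ k - prob {..<1} ^ k" by simp
qed

lemma expected_Opt_ge:
  assumes Y: "AE y in D. y \<in> {0..B}" and M: "1 \<le> M"
  shows "expected_Opt n D \<ge> (\<Sum>k=1..n. M - (M - 1) * prob {..<M} ^ k - prob {..<1} ^ k)"
proof -
  have "(\<Sum>k=1..n. M - (M - 1) * prob {..<M} ^ k - prob {..<1} ^ k)
      \<le> (\<Sum>k=1..n. \<integral>x. Max (x ` {1..k}) \<partial>iid n D)"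
    by (intro sum_mono integral_prefix_max_ge[OF Y M])
  also have "\<dots> = (\<integral>x. (\<Sum>k=1..n. Max (x ` {1..k})) \<partial>iid n D)"
    by (intro Bochner_Integration.integral_sum[symmetric] integral_prefix_max_ge[OF Y M])
  also have "\<dots> \<le> expected_Opt n D"
    unfolding expected_Opt_def
    by (intro integral_mono Bochner_Integration.integrable_sum integral_prefix_max_ge[OF Y M]
          integrable_Opt[OF Y] sum_prefix_max_le_Opt)
  finally show ?thesis .
qed

text \<open>In the pathwise bound, the mean of each gain term is the probability of being uncovered
  times the mean of \<open>gain\<close>. The last hypothesis makes that mean nonpositive, so only
  the charges remain.\<close>

lemma expected_Alg_le:
  assumes A: "online_algorithm n A"
    and Y: "AE y in D. y \<in> {0..\<eta>} \<union> {1..1 + \<eta>} \<union> {M..M + \<eta>}"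
    and \<eta>: "0 \<le> \<eta>" "\<eta> < 1" "1 + \<eta> < M"
    and b: "\<And>s. s \<in> {1..n} \<Longrightarrow> 1 \<le> b s"
    and gain: "\<And>i. i \<in> {1..n} \<Longrightarrow> M * real (n + 1 - i) * prob {M..} \<le> b i * prob {..<1}"
  shows "expected_Alg n D A \<le> (\<Sum>s=1..n. \<eta> + b s)"
proof -
  interpret P: prob_space "iid n D" by (rule prob_space_iid)
  define w where "w i x = of_bool (\<not> covered (choices A x) i) * gain n M b i (x i)" for i x
  have g_eq: "gain n M b i = (\<lambda>y. - b i * indicator {..<1} y + M * real (n + 1 - i) * indicator {M..} y)" for i
    using \<eta> by (auto simp: gain_def fun_eq_iff indicator_def)
  have gi: "integrable D (gain n M b i)" for i
    unfolding g_eq by (auto simp: emeasure_eq_measure sets_D)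
  have g_int: "(\<integral>y. gain n M b i y \<partial>D) = - b i * prob {..<1} + M * real (n + 1 - i) * prob {M..}" for i
    unfolding g_eq by (subst Bochner_Integration.integral_add) (auto simp: emeasure_eq_measure sets_D)
  have "(\<integral>y. gain n M b i y \<partial>D) \<le> 0" if "i \<in> {1..n}" for i
    unfolding g_int using gain[OF that] by simp
  then have w_neg: "(\<integral>x. w i x \<partial>iid n D) \<le> 0" if "i \<in> {1..n}" for i
    unfolding w_def using that by (subst integral_uncovered(2)[OF A that gi]) (simp add: mult_nonneg_nonpos)
  have w_int: "integrable (iid n D) (w i)" if "i \<in> {1..n}" for i
    unfolding w_def by (rule integral_uncovered(1)[OF A that gi])
  then have sum_int: "integrable (iid n D) (\<lambda>x. \<Sum>i=1..n. w i x)"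
    by (intro Bochner_Integration.integrable_sum)
  have "expected_Alg n D A \<le> (\<integral>x. (\<Sum>s=1..n. \<eta> + b s) + (\<Sum>i=1..n. w i x) \<partial>iid n D)"
    unfolding expected_Alg_def
  proof (rule integral_mono_AE')
    have AE: "AE x in iid n D. \<forall>i\<in>{1..n}. x i \<in> {0..\<eta>} \<union> {1..1 + \<eta>} \<union> {M..M + \<eta>}"
      by (rule AE_iid[OF Y])
    have fe: "feasible n (choices A x)" for x using A unfolding online_algorithm_def by blast
    have tv: "AE x in iid n D. total_value n x (choices A x) \<le> (\<Sum>s=1..n. \<eta> + b s) + (\<Sum>i=1..n. w i x)"
      using AE by eventually_elim (unfold w_def, intro total_value_le fe b; use \<eta> in simp)
    then show "AE x in iid n D. total_value n x (choices A x) \<le> (\<Sum>s=1..n. \<eta> + b s) + (\<Sum>i=1..n. w i x)" .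
    \<comment> \<open>\<open>integral_mono_AE'\<close> asks for a nonnegative bound; this one
      dominates a nonnegative total value.\<close>
    show "AE x in iid n D. 0 \<le> (\<Sum>s=1..n. \<eta> + b s) + (\<Sum>i=1..n. w i x)"
      using AE tv
    proof eventually_elim
      case (elim x)
      have "x i \<in> {0..M + \<eta>}" if "i \<in> {1..n}" for i
        using bspec[OF elim(1) that] \<eta> by auto
      from total_value_bounds[of n "choices A x" x, OF fe this] elim(2) show ?case by simp
    qed
  qed (use sum_int in auto)
  also have "\<dots> = (\<Sum>s=1..n. \<eta> + b s) + (\<Sum>i=1..n. \<integral>x. w i x \<partial>iid n D)"
    using sum_int w_int by (simp add: P.prob_space Bochner_Integration.integral_sum)
  also have "\<dots> \<le> (\<Sum>s=1..n. \<eta> + b s)" using sum_nonpos[of "{1..n}" "\<lambda>i. \<integral>x. w i x \<partial>iid n D"] w_neg by simp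
  finally show ?thesis .
qed

end

subsection \<open>The hard distribution\<close>

text \<open>Spreading each atom uniformly over width \<open>\<eta>\<close> provides a density. The
  conditions on \<open>\<eta>\<close> keep the three intervals apart at the thresholds 1 and
  \<open>M\<close>, so the masses stay exact.\<close>

lemma three_level_distribution:
  fixes \<eta> p q M :: real
  assumes \<eta>: "0 < \<eta>" "\<eta> < 1" "1 + \<eta> < M" and pq: "0 \<le> p" "0 < q" "p + q \<le> 1"
  obtains D where "admissible_distribution D" "real_prob D"
    "AE y in D. y \<in> {0..\<eta>} \<union> {1..1 + \<eta>} \<union> {M..M + \<eta>}"
    "measure D {..<1} = 1 - p - q" "measure D {..<M} = 1 - q" "measure D {M..} = q"
proof -
  define f where "f y = (1 - p - q) / \<eta> * indicator {0..\<eta>} y + p / \<eta> * indicator {1..1 + \<eta>} y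
      + q / \<eta> * indicator {M..M + \<eta>} y" for y :: real
  define D where "D = density lborel (\<lambda>y. ennreal (f y))"
  have f_meas [measurable]: "f \<in> borel_measurable borel" unfolding f_def by measurable
  have f_nonneg: "0 \<le> f y" for y using \<eta> pq unfolding f_def by (intro add_nonneg_nonneg) auto
  have em: "emeasure D A = ennreal ((1 - p - q) / \<eta>) * emeasure lborel ({0..\<eta>} \<inter> A)
      + ennreal (p / \<eta>) * emeasure lborel ({1..1 + \<eta>} \<inter> A)
      + ennreal (q / \<eta>) * emeasure lborel ({M..M + \<eta>} \<inter> A)" if [measurable]: "A \<in> sets borel" for A
  proof -
    have "emeasure D A = (\<integral>\<^sup>+y. ennreal (f y) * indicator A y \<partial>lborel)"
      unfolding D_def by (rule emeasure_density) auto
    also have "\<dots> = (\<integral>\<^sup>+y. ennreal ((1 - p - q) / \<eta>) * indicator ({0..\<eta>} \<inter> A) y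
        + ennreal (p / \<eta>) * indicator ({1..1 + \<eta>} \<inter> A) y
        + ennreal (q / \<eta>) * indicator ({M..M + \<eta>} \<inter> A) y \<partial>lborel)"
      using \<eta> pq by (intro nn_integral_cong) (auto simp: f_def indicator_def)
    also have "\<dots> = ennreal ((1 - p - q) / \<eta>) * emeasure lborel ({0..\<eta>} \<inter> A)
      + ennreal (p / \<eta>) * emeasure lborel ({1..1 + \<eta>} \<inter> A)
      + ennreal (q / \<eta>) * emeasure lborel ({M..M + \<eta>} \<inter> A)"
      by (simp add: nn_integral_add nn_integral_cmult_indicator)
    finally show ?thesis .
  qed
  have sets_D: "sets D = sets borel" by (simp add: D_def)
  have space_D: "space D = UNIV" by (simp add: D_def)
  have scale: "ennreal (a / \<eta>) * ennreal \<eta> = ennreal a" if "0 \<le> a" for a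
    using \<eta> that by (simp flip: ennreal_mult)
  have Int: "{0..\<eta>} \<inter> {..<1} = {0..\<eta>}" "{1..1 + \<eta>} \<inter> {..<1} = {}" "{M..M + \<eta>} \<inter> {..<1} = {}"
      "{0..\<eta>} \<inter> {..<M} = {0..\<eta>}" "{1..1 + \<eta>} \<inter> {..<M} = {1..1 + \<eta>}" "{M..M + \<eta>} \<inter> {..<M} = {}"
      "{0..\<eta>} \<inter> {M..} = {}" "{1..1 + \<eta>} \<inter> {M..} = {}" "{M..M + \<eta>} \<inter> {M..} = {M..M + \<eta>}"
      "{0..\<eta>} \<inter> {..0} = {0}" "{1..1 + \<eta>} \<inter> {..0} = {}" "{M..M + \<eta>} \<inter> {..0} = {}"
    using \<eta> by auto
  have D_low: "emeasure D {..<1} = ennreal (1 - p - q)"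
    using \<eta> pq by (simp add: em Int scale)
  have D_mid: "emeasure D {..<M} = ennreal (1 - q)"
    using \<eta> pq by (simp add: em Int scale flip: ennreal_plus)
  have D_high: "emeasure D {M..} = ennreal q"
    using \<eta> pq by (simp add: em Int scale)
  have "emeasure D (space D) = emeasure D UNIV" by (simp add: D_def)
  also have "\<dots> = 1" using \<eta> pq by (simp add: em scale flip: ennreal_plus)
  finally interpret D: prob_space D by (rule prob_spaceI)
  have rp: "real_prob D" using sets_D by unfold_locales
  have AE: "AE y in D. y \<in> {0..\<eta>} \<union> {1..1 + \<eta>} \<union> {M..M + \<eta>}"
    unfolding D_def by (subst AE_density) (auto intro!: AE_I2 simp: f_def indicator_def)
  have int: "integrable D (\<lambda>y. y)"
  proof (rule D.integrable_const_bound)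
    show "AE y in D. norm y \<le> M + \<eta>" using AE by eventually_elim (use \<eta> in auto)
  qed (simp add: D_def)
  \<comment> \<open>The mean is positive because the indicator of \<open>{M..}\<close>, of mean
    \<open>q\<close>, lies almost surely below the identity.\<close>
  have "0 < q" by fact
  also have "q = (\<integral>y. indicator {M..} y \<partial>D)"
    using pq by (simp add: measure_def D_high space_D)
  also have "\<dots> \<le> (\<integral>y. y \<partial>D)"
  proof (rule integral_mono_AE[OF _ int])
    show "integrable D (indicator {M..} :: real \<Rightarrow> real)"
      by (simp add: D_high sets_D)
    show "AE y in D. indicator {M..} y \<le> y" using AE by eventually_elim (use \<eta> in auto)
  qed
  finally have pos: "0 < (\<integral>y. y \<partial>D)" .
  have "real_distribution D"
    by (intro real_distribution.intro real_distribution_axioms.intro D.prob_space_axioms)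
       (simp_all add: D_def)
  moreover have "cdf D 0 = 0"
  proof -
    have "emeasure D {..0} = 0" by (subst em) (simp_all only: Int, simp_all)
    then show ?thesis by (simp add: cdf_def measure_def)
  qed
  ultimately have "admissible_distribution D"
    unfolding admissible_distribution_def using int pos f_meas f_nonneg D_def by blast
  with rp AE D_low D_mid D_high pq show ?thesis by (intro that) (auto simp: measure_def)
qed

section \<open>Estimates for the sums of both sides\<close>

text \<open>The excess over 1 is a discretised triangle of slope \<open>d\<close>, whose area is the
  squared height over \<open>2 * d\<close>. The shift to \<open>m + 1\<close> makes the induction
  telescope.\<close>

lemma sum_max_one_le:
  fixes d :: real
  assumes d: "0 < d"
  shows "(\<Sum>j=1..m. max 1 (d * real j)) \<le> real m + (max 0 (d * real (m + 1) - 1))\<^sup>2 / (2 * d)"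
proof (induction m)
  case 0
  show ?case using d by simp
next
  case (Suc m)
  define u where "u = d * real (m + 1) - 1"
  \<comment> \<open>Convexity of the squared positive part: its increment over a step
    \<open>d\<close> is at least \<open>d\<close> times the slope at \<open>u\<close>.\<close>
  have "2 * d * max 0 u \<le> (max 0 (u + d))\<^sup>2 - (max 0 u)\<^sup>2"
    using d by (cases "0 \<le> u") (auto simp: power2_eq_square algebra_simps)
  then have "2 * d * max 0 u / (2 * d) \<le> ((max 0 (u + d))\<^sup>2 - (max 0 u)\<^sup>2) / (2 * d)"
    using d by (intro divide_right_mono) auto
  then have "max 0 u \<le> (max 0 (u + d))\<^sup>2 / (2 * d) - (max 0 u)\<^sup>2 / (2 * d)"
    using d by (simp add: diff_divide_distrib)
  moreover have "max 1 (d * real (Suc m)) = 1 + max 0 u" by (auto simp: u_def max_def)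
  moreover have "(\<Sum>j=1..Suc m. max 1 (d * real j)) = (\<Sum>j=1..m. max 1 (d * real j)) + max 1 (d * real (Suc m))"
    by simp
  moreover have shift: "d * real (Suc m + 1) - 1 = u + d" by (simp add: u_def algebra_simps)
  ultimately show ?case using Suc.IH[folded u_def] unfolding shift by linarith
qed

text \<open>Second-order upper counterpart of Bernoulli's inequality; the error made in each
  induction step has a favourable sign.\<close>

lemma one_minus_power_le:
  fixes q :: real
  assumes "0 \<le> q" "q \<le> 1"
  shows "(1 - q) ^ k \<le> 1 - real k * q + (real k * q)\<^sup>2 / 2"
proof (induction k)
  case (Suc k)
  have "(1 - q) ^ Suc k \<le> (1 - q) * (1 - real k * q + (real k * q)\<^sup>2 / 2)"
    using Suc.IH assms by (simp add: mult_left_mono)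
  also have "\<dots> = 1 - real (Suc k) * q + (real (Suc k) * q)\<^sup>2 / 2 - (q\<^sup>2 / 2 + q * (real k * q)\<^sup>2 / 2)"
    by (simp add: field_simps power2_eq_square)
  finally have "(1 - q) ^ Suc k
      \<le> 1 - real (Suc k) * q + (real (Suc k) * q)\<^sup>2 / 2 - (q\<^sup>2 / 2 + q * (real k * q)\<^sup>2 / 2)" .
  moreover have "0 \<le> q\<^sup>2 / 2 + q * (real k * q)\<^sup>2 / 2" using assms by simp
  ultimately show ?case by linarith
qed simp

lemma sum_power_le:
  fixes r :: real
  assumes "0 \<le> r" "r < 1"
  shows "(\<Sum>k=1..n. r ^ k) \<le> 1 / (1 - r)"
proof -
  have "(\<Sum>k=1..n. r ^ k) \<le> (\<Sum>k. r ^ k)"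
    using assms by (intro sum_le_suminf) (auto intro: summable_geometric)
  then show ?thesis using assms by (simp add: suminf_geometric)
qed

text \<open>Each summand is \<open>M * (1 - (1 - q) ^ k) + (1 - q) ^ k - (1 - p - q) ^ k\<close>.
  The first part is bounded to second order, the second by Bernoulli, and the third sums to at most
  \<open>1 / p\<close>.\<close>

lemma expected_max_sum_ge:
  fixes M p q :: real
  assumes M: "0 \<le> M" and pq: "0 < p" "0 \<le> q" "p + q \<le> 1"
  shows "(\<Sum>k=1..n. M - (M - 1) * (1 - q) ^ k - (1 - p - q) ^ k)
    \<ge> M * q * (1 - real n * q / 2) * (real n * (real n + 1) / 2) + real n * (1 - real n * q) - 1 / p"
proof -
  have k_bound: "M * q * (1 - real n * q / 2) * real k + (1 - real n * q) - (1 - p - q) ^ k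
      \<le> M - (M - 1) * (1 - q) ^ k - (1 - p - q) ^ k" if k: "k \<in> {1..n}" for k
  proof -
    \<comment> \<open>One factor \<open>k\<close> is replaced by \<open>n\<close>, leaving a bound
      linear in \<open>k\<close>.\<close>
    have "(real k * q)\<^sup>2 \<le> real k * q * (real n * q)"
      unfolding power2_eq_square using k pq by (intro mult_left_mono mult_right_mono) auto
    then have "q * (1 - real n * q / 2) * real k \<le> 1 - (1 - q) ^ k"
      using one_minus_power_le[of q k] pq by (simp add: algebra_simps)
    then have "M * (q * (1 - real n * q / 2) * real k) \<le> M * (1 - (1 - q) ^ k)"
      using M by (rule mult_left_mono)
    moreover have "1 - real n * q \<le> (1 - q) ^ k"
    proof -
      have "1 - real n * q \<le> 1 + real k * (- q)" using k pq by (simp add: mult_right_mono)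
      also have "\<dots> \<le> (1 + (- q)) ^ k" using pq by (intro Bernoulli_inequality) auto
      finally show ?thesis by simp
    qed
    ultimately show ?thesis by (simp add: algebra_simps)
  qed
  have gauss: "(\<Sum>k=1..n. real k) = real n * (real n + 1) / 2"
    by (induction n) (auto simp: field_simps)
  have "(\<Sum>k=1..n. (1 - p - q) ^ k) \<le> 1 / (1 - (1 - p - q))"
    using pq by (intro sum_power_le) auto
  also have "\<dots> \<le> 1 / p" using pq by (intro divide_left_mono) auto
  finally have power_sum: "(\<Sum>k=1..n. (1 - p - q) ^ k) \<le> 1 / p" .
  have "(\<Sum>k=1..n. M * q * (1 - real n * q / 2) * real k + (1 - real n * q) - (1 - p - q) ^ k)
      = M * q * (1 - real n * q / 2) * (\<Sum>k=1..n. real k) + real n * (1 - real n * q) - (\<Sum>k=1..n. (1 - p - q) ^ k)"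
    by (simp add: sum.distrib sum_subtractf sum_distrib_left)
  then have "M * q * (1 - real n * q / 2) * (real n * (real n + 1) / 2) + real n * (1 - real n * q) - 1 / p
      \<le> (\<Sum>k=1..n. M * q * (1 - real n * q / 2) * real k + (1 - real n * q) - (1 - p - q) ^ k)"
    using power_sum unfolding gauss by linarith
  also have "\<dots> \<le> (\<Sum>k=1..n. M - (M - 1) * (1 - q) ^ k - (1 - p - q) ^ k)"
    by (intro sum_mono k_bound)
  finally show ?thesis .
qed

section \<open>Choice of parameters and passage to the limit\<close>

lemma prophet_ratio_le:
  fixes c \<eta> p q M d :: real
  assumes \<eta>: "0 < \<eta>" "\<eta> < 1" "1 + \<eta> < M" and pq: "0 < p" "0 < q" "p + q \<le> 1"
    and d: "0 < d" "M * q = d * (1 - p - q)"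
    and U: "real n * \<eta> + real n + (max 0 (d * real (n + 1) - 1))\<^sup>2 / (2 * d) \<le> U"
    and L: "0 < L" "L \<le> M * q * (1 - real n * q / 2) * (real n * (real n + 1) / 2)
      + real n * (1 - real n * q) - 1 / p"
  shows "prophet_ratio n \<le> ereal (U / L)"
proof -
  obtain D where D: "admissible_distribution D" "real_prob D"
    "AE y in D. y \<in> {0..\<eta>} \<union> {1..1 + \<eta>} \<union> {M..M + \<eta>}"
    "measure D {..<1} = 1 - p - q" "measure D {..<M} = 1 - q" "measure D {M..} = q"
    using three_level_distribution[of \<eta> M p q] \<eta> pq by auto
  interpret real_prob D by fact
  have "AE y in D. y \<in> {0..M + \<eta>}" using D(3) by eventually_elim (use \<eta> in auto)
  then have "(\<Sum>k=1..n. M - (M - 1) * (1 - q) ^ k - (1 - p - q) ^ k) \<le> expected_Opt n D"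
    using expected_Opt_ge[of "M + \<eta>" M n] D \<eta> by simp
  then have opt: "L \<le> expected_Opt n D"
    using L(2) expected_max_sum_ge[of M p q n] \<eta> pq by simp
  have alg: "expected_Alg n D A \<le> U" if "online_algorithm n A" for A
  proof -
    \<comment> \<open>With \<open>j = n + 1 - s\<close> steps left, the mean gain is
      \<open>(d * j - b s) * (1 - p - q)\<close>; hence this is the smallest charge that is at least
      1 and makes it nonpositive.\<close>
    let ?b = "\<lambda>s. max 1 (d * real (n + 1 - s))"
    have gain_le: "M * real (n + 1 - i) * measure D {M..} \<le> ?b i * measure D {..<1}" for i
    proof -
      have "M * real (n + 1 - i) * q = M * q * real (n + 1 - i)" by simp
      also have "\<dots> = d * real (n + 1 - i) * (1 - p - q)" unfolding d(2) by simp
      also have "\<dots> \<le> ?b i * (1 - p - q)" using pq by (intro mult_right_mono) auto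
      finally show ?thesis using D by simp
    qed
    have "expected_Alg n D A \<le> (\<Sum>s=1..n. \<eta> + ?b s)"
      using \<eta> by (intro expected_Alg_le[OF that D(3)] gain_le) auto
    also have "\<dots> = real n * \<eta> + (\<Sum>j=1..n. max 1 (d * real j))"
      unfolding sum.distrib by (subst (2) sum.atLeastAtMost_rev) simp
    also have "\<dots> \<le> U" using U sum_max_one_le[OF d(1), of n] by simp
    finally show ?thesis .
  qed
  \<comment> \<open>Replacing the denominator by the smaller \<open>L\<close> requires a nonnegative
    numerator bound.\<close>
  have "0 \<le> U"
  proof -
    have "0 \<le> real n * \<eta> + real n + (max 0 (d * real (n + 1) - 1))\<^sup>2 / (2 * d)"
      using \<eta> d by (intro add_nonneg_nonneg) auto
    with U show ?thesis by linarith
  qed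
  have "(SUP A\<in>{A. online_algorithm n A}. ereal (expected_Alg n D A / expected_Opt n D)) \<le> ereal (U / L)"
    using alg opt L(1) \<open>0 \<le> U\<close> by (intro SUP_least) (auto intro!: frac_le)
  then show ?thesis unfolding prophet_ratio_def using D(1) by (intro INF_lower2[of D]) auto
qed

theorem theorem3: "limsup prophet_ratio \<le> ereal (1 / golden_ratio)"
proof -
  define c where "c = golden_ratio"
  have c: "1 < c" unfolding c_def golden_ratio_def
    by (simp add: real_less_rsqrt field_simps)
  have c2: "c\<^sup>2 = c + 1"
    unfolding c_def golden_ratio_def by (simp add: power2_eq_square field_simps)
  \<comment> \<open>This is \<open>1 - p - q\<close> for \<open>p = 1 / sqrt n\<close> and
    \<open>q = 1 / n^2\<close>. Then \<open>n * q\<close> tends to 0 and \<open>1 / p\<close> is of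
    lower order than \<open>n\<close>, while \<open>M = c * r n * n\<close> makes \<open>d\<close>
    exactly \<open>c / n\<close>. With \<open>\<eta> = 1 / n\<close> the smearing costs 1 in
    total.\<close>
  define r where "r n = 1 - 1 / sqrt (real n) - 1 / (real n)\<^sup>2" for n
  define U where "U n = 1 + real n + real n * (c - 1 + c / real n)\<^sup>2 / (2 * c)" for n
  define L where "L n = c * r n * (1 - 1 / (2 * real n)) * (real n + 1) / 2 + real n - 1 - sqrt (real n)" for n
  have "eventually (\<lambda>n. 0 < r n) sequentially" unfolding r_def by real_asymp
  moreover have "eventually (\<lambda>n. 0 < L n) sequentially"
    unfolding L_def r_def using c by real_asymp
  moreover have "eventually (\<lambda>n. 1 + 1 / real n < c * r n * real n) sequentially"
    unfolding r_def using c by real_asymp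
  ultimately have "eventually (\<lambda>n. prophet_ratio n \<le> ereal (U n / L n)) sequentially"
    using eventually_gt_at_top[of 1]
  proof eventually_elim
    case (elim n)
    then have n: "1 < real n" by simp
    show ?case
    proof (rule prophet_ratio_le[of "1 / real n" "c * r n * real n" "1 / sqrt (real n)" "1 / (real n)\<^sup>2" "c / real n"])
      show "c * r n * real n * (1 / (real n)\<^sup>2) = c / real n * (1 - 1 / sqrt (real n) - 1 / (real n)\<^sup>2)"
        using n by (simp add: r_def power2_eq_square)
      have "c / real n * real (n + 1) - 1 = c - 1 + c / real n" using n by (simp add: field_simps)
      moreover have "0 \<le> c - 1 + c / real n" using c by simp
      ultimately have max: "max 0 (c / real n * real (n + 1) - 1) = c - 1 + c / real n" by simp
      show "real n * (1 / real n) + real n + (max 0 (c / real n * real (n + 1) - 1))\<^sup>2 / (2 * (c / real n)) \<le> U n"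
        unfolding max U_def using n by (simp add: mult.commute)
      show "L n \<le> c * r n * real n * (1 / (real n)\<^sup>2) * (1 - real n * (1 / (real n)\<^sup>2) / 2) *
          (real n * (real n + 1) / 2) + real n * (1 - real n * (1 / (real n)\<^sup>2)) - 1 / (1 / sqrt (real n))"
        using n by (simp add: L_def field_simps power2_eq_square)
    qed (use elim n c in \<open>auto simp: r_def\<close>)
  qed
  then have "limsup prophet_ratio \<le> limsup (\<lambda>n. ereal (U n / L n))"
    by (rule Limsup_mono)
  also have "(\<lambda>n. U n / L n) \<longlonglongrightarrow> (1 + (c - 1)\<^sup>2 / (2 * c)) / (1 + c / 2)"
  proof -
    have "(\<lambda>n. U n / L n) \<longlonglongrightarrow> (1 + (c - 1)\<^sup>2 * inverse c / 2) * inverse (c / 2 + 1)"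
      unfolding U_def L_def r_def using c by real_asymp
    then show ?thesis by (simp add: field_simps)
  qed
  then have "limsup (\<lambda>n. ereal (U n / L n)) = ereal ((1 + (c - 1)\<^sup>2 / (2 * c)) / (1 + c / 2))"
    by (intro lim_imp_Limsup) auto
  also have "(1 + (c - 1)\<^sup>2 / (2 * c)) / (1 + c / 2) = (c\<^sup>2 + 1) / (c * (c + 2))"
    using c by (simp add: divide_simps power2_eq_square) (simp add: algebra_simps)
  \<comment> \<open>The golden ratio equation turns the numerator into \<open>c + 2\<close>, which
    cancels.\<close>
  also have "\<dots> = 1 / c" unfolding c2 using c by (simp add: divide_simps)
  finally show ?thesis by (simp add: c_def)
qed

end
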